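(* Let $n\ge1$ and $\theta=(w,b)\in\mathbb{R}^{n\times n}\times\mathbb{R}^n$, and let $P_\theta$ be the Markov kernel of the Little model on $X=\{0,1\}^n$. Then for any two probability measures $\mu_1,\mu_2$ on $X$, $$d_{TV}(\mu_1P_\theta,\mu_2P_\theta)\le\left(1-\sigma\left(-\|w\|_\infty-\|b\|_\infty\right)^n\right)d_{TV}(\mu_1,\mu_2).$$
   Context: $\sigma(s)=1/(1+e^{-s})$. For $\theta=(w,b)$ and $x\in X=\{0,1\}^n$ let $u_i(x,\theta)=\sum_{j=1}^n w_{i,j}x_j+b_i$. The Markov kernel of the Little model is $$P_\theta(x^0,x^1)=\prod_{i=1}^n\sigma(u_i(x^0,\theta))^{x_i^1}\,(1-\sigma(u_i(x^0,\theta)))^{1-x_i^1},\qquad x^0,x^1\in X.$$ For a probability measure $\mu$ on $X$, $(\mu P_\theta)(y)=\sum_x\mu(x)P_\theta(x,y)$. The total variation distance is $d_{TV}(\mu_1,\mu_2)=\sup_{B\subseteq X}|\mu_1(B)-\mu_2(B)|$. For a vector, $\|\cdot\|_\infty$ is the maximum absolute entry; for a matrix, $\|w\|_\infty=\sup_{\|u\|_\infty=1}\|wu\|_\infty$. *)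

theory Defs
  imports "HOL-Analysis.Analysis" "HOL-Probability.Probability"
begin

text \<open>The state space \<open>{0,1}\<^sup>n\<close> is the type \<^typ>\<open>bool ^ 'n\<close> with \<open>n = CARD('n)\<close>;
  \<^const>\<open>of_bool\<close> turns the entries into the numbers 0 and 1.\<close>

definition sigmoid :: "real \<Rightarrow> real" where
  "sigmoid s = 1 / (1 + exp (- s))"

definition little_input ::
    "real ^ 'n ^ 'n \<Rightarrow> real ^ 'n \<Rightarrow> bool ^ 'n \<Rightarrow> 'n::finite \<Rightarrow> real" where
  "little_input w b x i = (\<Sum>j\<in>UNIV. w $ i $ j * of_bool (x $ j)) + b $ i"

definition little_kernel ::
    "real ^ 'n ^ 'n \<Rightarrow> real ^ 'n::finite \<Rightarrow> bool ^ 'n \<Rightarrow> bool ^ 'n \<Rightarrow> real" where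
  "little_kernel w b x y =
     (\<Prod>i\<in>UNIV. sigmoid (little_input w b x i) ^ of_bool (y $ i) *
        (1 - sigmoid (little_input w b x i)) ^ (1 - of_bool (y $ i)))"

text \<open>\<^const>\<open>embed_pmf\<close> is only meaningful when the weights are nonnegative and sum to 1;
  for the Little kernel this is \<open>pmf_apply_little_kernel\<close> below.\<close>

definition apply_kernel :: "'a::finite pmf \<Rightarrow> ('a \<Rightarrow> 'a \<Rightarrow> real) \<Rightarrow> 'a pmf" where
  "apply_kernel \<mu> P = embed_pmf (\<lambda>y. \<Sum>x\<in>UNIV. pmf \<mu> x * P x y)"

definition d_TV :: "'a pmf \<Rightarrow> 'a pmf \<Rightarrow> real" where
  "d_TV \<mu>1 \<mu>2 = (SUP B. \<bar>measure_pmf.prob \<mu>1 B - measure_pmf.prob \<mu>2 B\<bar>)"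

text \<open>The maximum norm of a vector is the library's \<^const>\<open>infnorm\<close>.\<close>

definition matrix_infnorm :: "real ^ 'n ^ 'm \<Rightarrow> real" where
  "matrix_infnorm w = (SUP u\<in>{u. infnorm u = 1}. infnorm (w *v u))"

lemma sigmoid_bounds: "0 < sigmoid s" "sigmoid s < 1"
  by (auto simp: sigmoid_def field_simps add_pos_pos)

lemma little_kernel_nonneg: "0 \<le> little_kernel w b x y"
  unfolding little_kernel_def
  by (intro prod_nonneg ballI mult_nonneg_nonneg zero_le_power)
     (use sigmoid_bounds less_imp_le in auto)

lemma sum_little_kernel: "(\<Sum>y\<in>UNIV. little_kernel w b x y) = 1"
proof -
  let ?g = "\<lambda>i v. sigmoid (little_input w b x i) ^ of_bool v *
        (1 - sigmoid (little_input w b x i)) ^ (1 - of_bool v)"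
  have "(\<Sum>y\<in>UNIV. little_kernel w b x y) = (\<Sum>f\<in>UNIV. little_kernel w b x (vec_lambda f))"
    by (rule sum.reindex_bij_witness[where i = vec_lambda and j = vec_nth]) auto
  also have "\<dots> = (\<Sum>f\<in>PiE UNIV (\<lambda>_. UNIV). \<Prod>i\<in>UNIV. ?g i (f i))"
    by (simp add: little_kernel_def)
  also have "\<dots> = (\<Prod>i\<in>UNIV. \<Sum>v\<in>UNIV. ?g i v)"
    by (rule prod_sum_PiE[symmetric]) auto
  also have "\<dots> = 1"
    by (simp add: UNIV_bool)
  finally show ?thesis .
qed

lemma pmf_apply_little_kernel:
  "pmf (apply_kernel \<mu> (little_kernel w b)) y = (\<Sum>x\<in>UNIV. pmf \<mu> x * little_kernel w b x y)"
proof -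
  have nn: "0 \<le> (\<Sum>x\<in>UNIV. pmf \<mu> x * little_kernel w b x z)" for z
    by (intro sum_nonneg mult_nonneg_nonneg) (auto simp: little_kernel_nonneg)
  have "(\<Sum>z\<in>UNIV. \<Sum>x\<in>UNIV. pmf \<mu> x * little_kernel w b x z)
      = (\<Sum>x\<in>UNIV. pmf \<mu> x * (\<Sum>z\<in>UNIV. little_kernel w b x z))"
    by (subst sum.swap) (simp add: sum_distrib_left)
  also have "\<dots> = 1"
    by (simp add: sum_little_kernel sum_pmf_eq_1)
  finally have "(\<integral>\<^sup>+ z. ennreal (\<Sum>x\<in>UNIV. pmf \<mu> x * little_kernel w b x z) \<partial>count_space UNIV) = 1"
    by (simp add: nn_integral_count_space_finite sum_ennreal nn)
  then show ?thesis
    unfolding apply_kernel_def using nn by (subst pmf_embed_pmf) auto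
qed

end

theory Submission
  imports Defs
begin

text \<open>
  Write \<open>c\<close> for \<open>\<parallel>w\<parallel>\<^sub>\<infinity> + \<parallel>b\<parallel>\<^sub>\<infinity>\<close> and \<open>\<epsilon>\<close> for \<open>\<sigma>(-c)\<^sup>n\<close>. The inputs \<open>u\<^sub>i(x)\<close> all lie in
  \<open>[-c, c]\<close>, because a 0/1 vector has maximum norm at most 1. Hence each factor of \<open>P\<^sub>\<theta>(x, y)\<close>,
  being \<open>\<sigma>(u\<^sub>i)\<close> or \<open>1 - \<sigma>(u\<^sub>i) = \<sigma>(-u\<^sub>i)\<close>, is at least \<open>\<sigma>(-c)\<close>, and the kernel satisfies the
  Doeblin condition \<open>P\<^sub>\<theta>(x, y) \<ge> \<epsilon>\<close> (\<open>little_kernel_ge\<close>).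

  Contraction follows by duality. For a nonempty set \<open>B\<close> of states, the difference
  \<open>(\<mu>\<^sub>1P\<^sub>\<theta>)(B) - (\<mu>\<^sub>2P\<^sub>\<theta>)(B)\<close> is the difference of the two expectations of the function
  \<open>x \<mapsto> P\<^sub>\<theta>(x, B)\<close>. This function takes values in \<open>[\<epsilon>, 1]\<close>, and the expectations of a function
  under two measures differ by at most its oscillation times the total variation distance
  (\<open>expectation_diff_le_d_TV\<close>). That gives the factor \<open>1 - \<epsilon>\<close>; for empty \<open>B\<close> the difference
  is 0.
\<close>

section \<open>Total variation and expectations\<close>

lemma prob_diff_le_d_TV:
  "\<bar>measure_pmf.prob \<mu>1 B - measure_pmf.prob \<mu>2 B\<bar> \<le> d_TV \<mu>1 \<mu>2"
proof -
  have "\<bar>measure_pmf.prob \<mu>1 C - measure_pmf.prob \<mu>2 C\<bar> \<le> 1" for C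
    using measure_pmf.prob_le_1[of \<mu>1 C] measure_pmf.prob_le_1[of \<mu>2 C]
      measure_nonneg[of "measure_pmf \<mu>1" C] measure_nonneg[of "measure_pmf \<mu>2" C]
    by linarith
  then have "bdd_above (range (\<lambda>C. \<bar>measure_pmf.prob \<mu>1 C - measure_pmf.prob \<mu>2 C\<bar>))"
    by (intro bdd_aboveI[of _ 1]) auto
  then show ?thesis
    unfolding d_TV_def by (rule cSUP_upper[OF UNIV_I])
qed

lemma d_TV_commute: "d_TV \<mu>1 \<mu>2 = d_TV \<mu>2 \<mu>1"
  by (simp add: d_TV_def abs_minus_commute)

text \<open>The two measures have the same total mass, so \<open>f\<close> may be replaced by \<open>f - a\<close>, which is
  nonnegative. Then only the states where \<open>\<mu>1\<close> exceeds \<open>\<mu>2\<close> contribute positively, and the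
  excess of mass on the set of these states is at most the total variation distance.\<close>

lemma expectation_diff_le_d_TV:
  fixes \<mu>1 \<mu>2 :: "'a::finite pmf"
  assumes f: "\<And>x. a \<le> f x" "\<And>x. f x \<le> c"
  shows "(\<Sum>x\<in>UNIV. (pmf \<mu>1 x - pmf \<mu>2 x) * f x) \<le> (c - a) * d_TV \<mu>1 \<mu>2"
proof -
  define d where "d x = pmf \<mu>1 x - pmf \<mu>2 x" for x
  let ?A = "{x. 0 \<le> d x}"
  have ac: "a \<le> c"
    using f order_trans by blast
  have "(\<Sum>x\<in>UNIV. d x) = 0"
    by (simp add: d_def sum_subtractf sum_pmf_eq_1)
  then have "(\<Sum>x\<in>UNIV. d x * f x) = (\<Sum>x\<in>UNIV. d x * (f x - a))"
    by (simp add: right_diff_distrib sum_subtractf flip: sum_distrib_right)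
  also have "\<dots> \<le> (\<Sum>x\<in>UNIV. if x \<in> ?A then (c - a) * d x else 0)"
  proof (intro sum_mono)
    fix x
    show "d x * (f x - a) \<le> (if x \<in> ?A then (c - a) * d x else 0)"
      using f[of x] by (auto simp: mult.commute[of "d x"] intro: mult_right_mono mult_nonneg_nonpos)
  qed
  also have "\<dots> = (c - a) * (\<Sum>x\<in>?A. d x)"
    by (simp add: sum.If_cases sum_distrib_left)
  also have "(\<Sum>x\<in>?A. d x) = measure_pmf.prob \<mu>1 ?A - measure_pmf.prob \<mu>2 ?A"
    by (simp add: d_def measure_measure_pmf_finite sum_subtractf)
  also have "(c - a) * \<dots> \<le> (c - a) * d_TV \<mu>1 \<mu>2"
    using prob_diff_le_d_TV[of \<mu>1 ?A \<mu>2] ac by (intro mult_left_mono) auto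
  finally show ?thesis
    by (simp add: d_def)
qed

text \<open>Doeblin's condition makes a Markov kernel a contraction: for nonempty \<open>B\<close> the function
  \<open>x \<mapsto> P(x, B)\<close> takes values in \<open>[\<epsilon>, 1]\<close>, so its oscillation is at most \<open>1 - \<epsilon>\<close>.\<close>

lemma d_TV_contraction:
  fixes P :: "'a::finite \<Rightarrow> 'b::finite \<Rightarrow> real" and \<nu>1 \<nu>2 :: "'b pmf"
  assumes \<nu>1: "\<And>y. pmf \<nu>1 y = (\<Sum>x\<in>UNIV. pmf \<mu>1 x * P x y)"
    and \<nu>2: "\<And>y. pmf \<nu>2 y = (\<Sum>x\<in>UNIV. pmf \<mu>2 x * P x y)"
    and P_sum: "\<And>x. (\<Sum>y\<in>UNIV. P x y) = 1"
    and \<epsilon>: "0 \<le> \<epsilon>" "\<And>x y. \<epsilon> \<le> P x y"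
  shows "d_TV \<nu>1 \<nu>2 \<le> (1 - \<epsilon>) * d_TV \<mu>1 \<mu>2"
proof -
  have P_nonneg: "0 \<le> P x y" for x y
    using \<epsilon> order_trans by blast
  have bound: "\<bar>measure_pmf.prob \<nu>1 B - measure_pmf.prob \<nu>2 B\<bar> \<le> (1 - \<epsilon>) * d_TV \<mu>1 \<mu>2" for B
  proof (cases "B = {}")
    case True
    have "P x y \<le> 1" for x y
      using member_le_sum[of y UNIV "P x"] P_nonneg P_sum by simp
    then have "\<epsilon> \<le> 1"
      using \<epsilon>(2) order_trans by blast
    moreover have "0 \<le> d_TV \<mu>1 \<mu>2"
      using prob_diff_le_d_TV[of \<mu>1 "{}" \<mu>2] by simp
    ultimately show ?thesis
      using True by simp
  next
    case False
    then obtain y0 where "y0 \<in> B" by blast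
    define f where "f x = (\<Sum>y\<in>B. P x y)" for x
    have ge: "\<epsilon> \<le> f x" for x
      using member_le_sum[of y0 B "P x"] \<open>y0 \<in> B\<close> \<epsilon>(2)[of x y0] P_nonneg by (simp add: f_def)
    have le: "f x \<le> 1" for x
      unfolding f_def P_sum[of x, symmetric] using P_nonneg by (intro sum_mono2) auto
    have prob: "measure_pmf.prob \<nu> B = (\<Sum>x\<in>UNIV. pmf \<mu> x * f x)"
      if "\<And>y. pmf \<nu> y = (\<Sum>x\<in>UNIV. pmf \<mu> x * P x y)" for \<mu> \<nu>
      unfolding f_def sum_distrib_left
      by (subst sum.swap) (simp add: measure_measure_pmf_finite that)
    have "measure_pmf.prob \<nu>1 B - measure_pmf.prob \<nu>2 B \<le> (1 - \<epsilon>) * d_TV \<mu>1 \<mu>2"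
      using expectation_diff_le_d_TV[of \<epsilon> f 1 \<mu>1 \<mu>2, OF ge le]
      by (simp add: prob[OF \<nu>1] prob[OF \<nu>2] left_diff_distrib sum_subtractf)
    moreover have "measure_pmf.prob \<nu>2 B - measure_pmf.prob \<nu>1 B \<le> (1 - \<epsilon>) * d_TV \<mu>1 \<mu>2"
      using expectation_diff_le_d_TV[of \<epsilon> f 1 \<mu>2 \<mu>1, OF ge le]
      by (simp add: prob[OF \<nu>1] prob[OF \<nu>2] left_diff_distrib sum_subtractf d_TV_commute[of \<mu>2])
    ultimately show ?thesis
      by linarith
  qed
  show ?thesis
    unfolding d_TV_def[of \<nu>1] using bound by (intro cSUP_least) auto
qed

section \<open>The matrix norm\<close>

text \<open>Boundedness of the set of values comes from the operator norm for the Euclidean norm, since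
  the Euclidean and the maximum norm are equivalent.\<close>

lemma infnorm_le_matrix_infnorm:
  fixes w :: "real ^ 'n ^ 'm"
  assumes "infnorm u = 1"
  shows "infnorm (w *v u) \<le> matrix_infnorm w"
proof -
  have "infnorm (w *v v) \<le> onorm ((*v) w) * sqrt (real DIM(real ^ 'n))" if "infnorm v = 1" for v
  proof -
    have "infnorm (w *v v) \<le> norm (w *v v)"
      by (rule infnorm_le_norm)
    also have "\<dots> \<le> onorm ((*v) w) * norm v"
      by (rule onorm) (rule matrix_vector_mul_bounded_linear)
    also have "\<dots> \<le> onorm ((*v) w) * sqrt (real DIM(real ^ 'n))"
      using norm_le_infnorm[of v] that
      by (intro mult_left_mono onorm_pos_le matrix_vector_mul_bounded_linear) simp
    finally show ?thesis .
  qed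
  then have "bdd_above ((\<lambda>u. infnorm (w *v u)) ` {u. infnorm u = 1})"
    by (intro bdd_aboveI2) auto
  then show ?thesis
    unfolding matrix_infnorm_def using assms by (intro cSUP_upper) auto
qed

lemma infnorm_matrix_vector_mult_le:
  fixes w :: "real ^ 'n ^ 'm"
  shows "infnorm (w *v u) \<le> matrix_infnorm w * infnorm u"
proof (cases "u = 0")
  case False
  then have pos: "0 < infnorm u"
    by (simp add: infnorm_pos_lt)
  then have "infnorm (inverse (infnorm u) *\<^sub>R u) = 1"
    by (simp add: infnorm_mul)
  from infnorm_le_matrix_infnorm[OF this, of w]
  have "infnorm (w *v u) / infnorm u \<le> matrix_infnorm w"
    using pos by (simp add: matrix_vector_mult_scaleR infnorm_mul divide_inverse_commute)
  then show ?thesis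
    using pos by (simp add: field_simps)
qed (simp add: infnorm_0)

lemma matrix_infnorm_nonneg: "0 \<le> matrix_infnorm (w :: real ^ 'n ^ 'm)"
proof -
  let ?e = "axis undefined 1 :: real ^ 'n"
  have "0 < infnorm ?e"
    by (simp add: infnorm_pos_lt axis_eq_0_iff)
  moreover have "0 \<le> matrix_infnorm w * infnorm ?e"
    using infnorm_pos_le infnorm_matrix_vector_mult_le by (rule order_trans)
  ultimately show ?thesis
    by (simp add: zero_le_mult_iff)
qed

section \<open>A uniform lower bound for the Little kernel\<close>

lemma one_minus_sigmoid: "1 - sigmoid s = sigmoid (- s)"
proof -
  have "1 + exp s \<noteq> 0"
    using exp_gt_zero[of s] by linarith
  then show ?thesis
    by (simp add: sigmoid_def exp_minus divide_simps)
qed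

lemma sigmoid_mono: "s \<le> t \<Longrightarrow> sigmoid s \<le> sigmoid t"
  by (simp add: sigmoid_def frac_le add_pos_pos)

lemma abs_little_input_le:
  "\<bar>little_input w b x i\<bar> \<le> matrix_infnorm w + infnorm b"
proof -
  define v :: "real ^ 'a" where "v = (\<chi> j. of_bool (x $ j))"
  have "infnorm v \<le> 1"
    by (auto simp: infnorm_cart v_def intro!: cSup_least)
  have "\<bar>(w *v v) $ i\<bar> \<le> infnorm (w *v v)"
    by (rule component_le_infnorm_cart)
  also have "\<dots> \<le> matrix_infnorm w * infnorm v"
    by (rule infnorm_matrix_vector_mult_le)
  also have "\<dots> \<le> matrix_infnorm w"
    using mult_left_mono[OF \<open>infnorm v \<le> 1\<close> matrix_infnorm_nonneg] by simp
  finally have "\<bar>(w *v v) $ i\<bar> \<le> matrix_infnorm w" .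
  moreover have "little_input w b x i = (w *v v) $ i + b $ i"
    by (simp add: little_input_def matrix_vector_mult_def v_def)
  moreover have "\<bar>b $ i\<bar> \<le> infnorm b"
    by (rule component_le_infnorm_cart)
  ultimately show ?thesis
    by linarith
qed

lemma little_kernel_ge:
  fixes w :: "real ^ 'n ^ 'n" and b :: "real ^ 'n::finite"
  shows "sigmoid (- matrix_infnorm w - infnorm b) ^ CARD('n) \<le> little_kernel w b x y"
proof -
  let ?s = "sigmoid (- matrix_infnorm w - infnorm b)"
  have "?s ^ CARD('n) = (\<Prod>i\<in>(UNIV :: 'n set). ?s)"
    by simp
  also have "\<dots> \<le> little_kernel w b x y"
    unfolding little_kernel_def
  proof (intro prod_mono conjI)
    fix i
    show "0 \<le> ?s"
      using sigmoid_bounds less_imp_le by blast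
    have "?s \<le> sigmoid (little_input w b x i)" "?s \<le> sigmoid (- little_input w b x i)"
      using abs_little_input_le[of w b x i] by (auto intro!: sigmoid_mono)
    then show "?s \<le> sigmoid (little_input w b x i) ^ of_bool (y $ i) *
        (1 - sigmoid (little_input w b x i)) ^ (1 - of_bool (y $ i))"
      by (simp add: one_minus_sigmoid)
  qed
  finally show ?thesis .
qed

theorem mainTheorem2:
  fixes w :: "real ^ 'n ^ 'n" and b :: "real ^ 'n::finite"
    and \<mu>1 \<mu>2 :: "(bool ^ 'n) pmf"
  shows "d_TV (apply_kernel \<mu>1 (little_kernel w b)) (apply_kernel \<mu>2 (little_kernel w b))
      \<le> (1 - sigmoid (- matrix_infnorm w - infnorm b) ^ CARD('n)) * d_TV \<mu>1 \<mu>2"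
proof (rule d_TV_contraction)
  show "0 \<le> sigmoid (- matrix_infnorm w - infnorm b) ^ CARD('n)"
    using sigmoid_bounds less_imp_le by (intro zero_le_power) blast
qed (rule pmf_apply_little_kernel sum_little_kernel little_kernel_ge)+

end
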